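(* Let $G$ be a $2r$-regular graph of order $m\ge 3$ with $\chi(G)=\chi_{la}(G)$. If $r\ge 2$, $r\ge t\ge 1$ and $m-2t\ge 2$, then $\chi_{la}(G\vee O_{m-2t})=\chi_{la}(G)+1$. In particular, let $G_0=G$ and $G_{k+1}=G_k\vee O_{m-2r}$ for $k\ge 0$; if $m$ is even and $m-2r\ge 2$, then $G_{k+1}$ is a $(2r+(k+1)(m-2r))$-regular graph of order $m+(k+1)(m-2r)$, and $\chi_{la}(G_k)=\chi_{la}(G)+k$ for all $k\ge 0$.
   Context: $O_n$ denotes the graph on $n$ vertices with no edges. For vertex-disjoint graphs $G,H$, the join $G\vee H$ has vertex set $V(G)\cup V(H)$ and edge set $E(G)\cup E(H)\cup\{uv: u\in V(G), v\in V(H)\}$; in the iteration each $O_{m-2r}$ is a fresh vertex-disjoint copy. $\chi$ is the chromatic number. For a simple graph with $q$ edges, a bijection $f:E\to\{1,\dots,q\}$ is a local antimagic labeling if $f^+(u)\neq f^+(v)$ for every edge $uv$, where $f^+(u)=\sum_{e\ni u} f(e)$; $\chi_{la}$ is the minimum number of distinct values of $f^+$ over all local antimagic labelings. *)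

theory Defs
  imports Main "HOL-Library.Extended_Nat"
begin

record 'a graph =
  verts :: "'a set"
  edges :: "'a set set"

definition simple_graph :: "'a graph \<Rightarrow> bool" where
  "simple_graph G \<longleftrightarrow>
     finite (verts G) \<and> edges G \<subseteq> {e. e \<subseteq> verts G \<and> card e = 2}"

definition degree :: "'a graph \<Rightarrow> 'a \<Rightarrow> nat" where
  "degree G v = card {e \<in> edges G. v \<in> e}"

definition regular :: "nat \<Rightarrow> 'a graph \<Rightarrow> bool" where
  "regular d G \<longleftrightarrow> (\<forall>v \<in> verts G. degree G v = d)"

text \<open>The copy of the edgeless graph \<open>O\<^sub>n\<close> whose vertices are the \<open>n\<close> elements of \<open>W\<close>.\<close>

definition edgeless :: "'a set \<Rightarrow> 'a graph" where
  "edgeless W = \<lparr>verts = W, edges = {}\<rparr>"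

definition graph_join :: "'a graph \<Rightarrow> 'a graph \<Rightarrow> 'a graph" where
  "graph_join G H =
     \<lparr>verts = verts G \<union> verts H,
      edges = edges G \<union> edges H \<union> {{u, v} | u v. u \<in> verts G \<and> v \<in> verts H}\<rparr>"

text \<open>
  \<open>iterated_join G n k H\<close>: the graph \<open>H\<close> arises from \<open>G\<close> by joining \<open>k\<close> times with a copy
  of \<open>O\<^sub>n\<close>, each copy being vertex-disjoint from the graph built so far. The join depends, up to
  isomorphism, only on \<open>n\<close>, but the fresh vertices are not canonical, hence a relation.
\<close>

inductive iterated_join :: "'a graph \<Rightarrow> nat \<Rightarrow> nat \<Rightarrow> 'a graph \<Rightarrow> bool"
  for G :: "'a graph" and n :: nat where
  base: "iterated_join G n 0 G"
| step: "iterated_join G n k H \<Longrightarrow> finite W \<Longrightarrow> card W = n \<Longrightarrow> verts H \<inter> W = {} \<Longrightarrow>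
         iterated_join G n (Suc k) (graph_join H (edgeless W))"

lemma iterated_join_exists:
  assumes "infinite (UNIV :: 'a set)" and "finite (verts (G :: 'a graph))"
  shows "\<exists>H. iterated_join G n k H \<and> finite (verts H)"
proof (induction k)
  case 0
  show ?case using assms(2) by (blast intro: iterated_join.base)
next
  case (Suc k)
  then obtain H where H: "iterated_join G n k H" "finite (verts H)" by blast
  have "infinite (- verts H)"
    using assms(1) H(2) by (metis Compl_eq_Diff_UNIV Diff_infinite_finite)
  then obtain W where W: "W \<subseteq> - verts H" "finite W" "card W = n"
    using infinite_arbitrarily_large by blast
  then have "verts H \<inter> W = {}" by blast
  with H W have "iterated_join G n (Suc k) (graph_join H (edgeless W))"
    by (intro iterated_join.step)
  moreover have "finite (verts (graph_join H (edgeless W)))"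
    using H(2) W(2) by (simp add: graph_join_def edgeless_def)
  ultimately show ?case by blast
qed

definition proper_coloring :: "'a graph \<Rightarrow> ('a \<Rightarrow> nat) \<Rightarrow> bool" where
  "proper_coloring G c \<longleftrightarrow> (\<forall>u v. {u, v} \<in> edges G \<longrightarrow> c u \<noteq> c v)"

definition chromatic_number :: "'a graph \<Rightarrow> nat" where
  "chromatic_number G = (LEAST k. \<exists>c. proper_coloring G c \<and> c ` verts G \<subseteq> {..<k})"

definition vertex_sum :: "'a graph \<Rightarrow> ('a set \<Rightarrow> nat) \<Rightarrow> 'a \<Rightarrow> nat" where
  "vertex_sum G f u = (\<Sum>e \<in> {e \<in> edges G. u \<in> e}. f e)"

definition local_antimagic_labeling :: "'a graph \<Rightarrow> ('a set \<Rightarrow> nat) \<Rightarrow> bool" where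
  "local_antimagic_labeling G f \<longleftrightarrow>
     bij_betw f (edges G) {1..card (edges G)} \<and>
     (\<forall>u v. {u, v} \<in> edges G \<longrightarrow> vertex_sum G f u \<noteq> vertex_sum G f v)"

text \<open>
  The minimum lives in the extended naturals, so that it is \<open>\<infinity>\<close>, and not an arbitrary number,
  for a graph that has no local antimagic labeling.
\<close>

definition chi_la :: "'a graph \<Rightarrow> enat" where
  "chi_la G = (INF f \<in> {f. local_antimagic_labeling G f}. enat (card (vertex_sum G f ` verts G)))"

end

theory Submission imports Defs
begin

text \<open>
  Let \<open>G\<close> be \<open>d\<close>-regular of order \<open>m\<close>, and let \<open>n\<close> be the number of vertices of the edgeless graph.
  Label the \<open>m n\<close> new edges by a magic \<open>n \<times> m\<close> rectangle on \<open>1, \<dots>, m n\<close> and shift an optimal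
  labeling of \<open>G\<close> by \<open>m n\<close>. By regularity all vertex sums in \<open>G\<close> change by the same constant, the
  new vertices share one sum, and placing the labels of \<open>G\<close> on top makes that sum smaller than every
  sum in \<open>G\<close> as soon as \<open>m \<le> n + d\<close>. This gives \<open>\<chi>\<^sub>l\<^sub>a(G) + 1\<close> as an upper bound, and
  \<open>\<chi>(G \<or> O\<^sub>n) \<ge> \<chi>(G) + 1 = \<chi>\<^sub>l\<^sub>a(G) + 1\<close> is a lower bound. Hence the join again satisfies
  \<open>\<chi> = \<chi>\<^sub>l\<^sub>a\<close>, and one can iterate.

  Magic rectangles are obtained, after centering, by gluing arrays with vanishing row and column
  sums. Blocks \<open>2 \<times> 4\<close> with rows \<open>\<plusminus>(a, -(a+s), -(a+2s), a+3s)\<close> handle even sides. For odd sides,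
  a triple \<open>a + b = c\<close> gives a \<open>3 \<times> 2\<close> strip, and \<open>1, \<dots>, 3h+1\<close> is a disjoint union of \<open>h\<close> such
  triples and a single number: pairs in \<open>h+1, \<dots>, 3h+1\<close> with differences \<open>1, \<dots>, h\<close> are
  found by nesting the odd differences and, around that number, the even ones.
\<close>

section \<open>Zero-sum arrays\<close>

text \<open>
  Only a lower bound \<open>S\<close> for the set of entries is recorded: in the end \<open>S\<close> has \<open>p q\<close> elements, so
  counting shows that every element of \<open>S\<close> occurs exactly once and nothing else does.
\<close>

definition zero_sum_array :: "nat \<Rightarrow> nat \<Rightarrow> 'a::comm_monoid_add set \<Rightarrow> bool" where
  "zero_sum_array p q S \<longleftrightarrow>
     (\<exists>f. (\<forall>i<p. (\<Sum>j<q. f i j) = 0) \<and> (\<forall>j<q. (\<Sum>i<p. f i j) = 0) \<and>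
          (\<forall>x\<in>S. \<exists>i<p. \<exists>j<q. f i j = x))"

lemma zero_sum_array_mono:
  "zero_sum_array p q S \<Longrightarrow> T \<subseteq> S \<Longrightarrow> zero_sum_array p q T"
  unfolding zero_sum_array_def by blast

lemma zero_sum_array_transpose:
  assumes "zero_sum_array p q S"
  shows "zero_sum_array q p S"
proof -
  obtain f where "\<forall>i<p. (\<Sum>j<q. f i j) = 0" "\<forall>j<q. (\<Sum>i<p. f i j) = 0"
      "\<forall>x\<in>S. \<exists>i<p. \<exists>j<q. f i j = x"
    using assms unfolding zero_sum_array_def by blast
  then show ?thesis
    unfolding zero_sum_array_def by (intro exI[of _ "\<lambda>i j. f j i"]) blast
qed

lemma zero_sum_array_beside:
  assumes "zero_sum_array p q S" "zero_sum_array p q' T"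
  shows "zero_sum_array p (q + q') (S \<union> T)"
proof -
  obtain f where f: "\<And>i. i < p \<Longrightarrow> (\<Sum>j<q. f i j) = 0" "\<And>j. j < q \<Longrightarrow> (\<Sum>i<p. f i j) = 0"
      "\<And>x. x \<in> S \<Longrightarrow> \<exists>i<p. \<exists>j<q. f i j = x"
    using assms(1) unfolding zero_sum_array_def by blast
  obtain g where g: "\<And>i. i < p \<Longrightarrow> (\<Sum>j<q'. g i j) = 0" "\<And>j. j < q' \<Longrightarrow> (\<Sum>i<p. g i j) = 0"
      "\<And>x. x \<in> T \<Longrightarrow> \<exists>i<p. \<exists>j<q'. g i j = x"
    using assms(2) unfolding zero_sum_array_def by blast
  define k where "k i j = (if j < q then f i j else g i (j - q))" for i j
  have "(\<Sum>j<q + q'. k i j) = 0" if "i < p" for i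
  proof -
    have "(\<Sum>j<q + q'. k i j) = (\<Sum>j<q. k i j) + (\<Sum>j<q'. k i (q + j))"
      by (induction q') (simp_all add: add.assoc)
    then show ?thesis using f(1)[OF that] g(1)[OF that] by (simp add: k_def)
  qed
  moreover have "(\<Sum>i<p. k i j) = 0" if "j < q + q'" for j
    using f(2)[of j] g(2)[of "j - q"] that by (cases "j < q") (simp_all add: k_def)
  moreover have "\<exists>i<p. \<exists>j<q + q'. k i j = x" if x: "x \<in> S \<union> T" for x
  proof (cases "x \<in> S")
    case True
    then obtain i j where "i < p" "j < q" "f i j = x" using f(3) by blast
    then have "i < p" "j < q + q'" "k i j = x" by (simp_all add: k_def)
    then show ?thesis by blast
  next
    case False
    then obtain i j where "i < p" "j < q'" "g i j = x" using x g(3) by blast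
    then have "i < p" "q + j < q + q'" "k i (q + j) = x" by (simp_all add: k_def)
    then show ?thesis by blast
  qed
  ultimately show ?thesis
    unfolding zero_sum_array_def by blast
qed

lemma zero_sum_array_above:
  assumes "zero_sum_array p q S" "zero_sum_array p' q T"
  shows "zero_sum_array (p + p') q (S \<union> T)"
  using assms by (blast intro: zero_sum_array_beside zero_sum_array_transpose)

lemma zero_sum_array_scale:
  fixes S :: "'a::semiring_0 set"
  assumes "zero_sum_array p q S"
  shows "zero_sum_array p q ((*) a ` S)"
proof -
  obtain f where "\<forall>i<p. (\<Sum>j<q. f i j) = 0" "\<forall>j<q. (\<Sum>i<p. f i j) = 0"
      "\<forall>x\<in>S. \<exists>i<p. \<exists>j<q. f i j = x"
    using assms unfolding zero_sum_array_def by blast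
  then show ?thesis
    unfolding zero_sum_array_def
    by (intro exI[of _ "\<lambda>i j. a * f i j"]) (auto simp flip: sum_distrib_left, metis)
qed

lemma zero_sum_array_of_lists:
  assumes "length M = p" "\<forall>xs\<in>set M. length xs = q \<and> sum_list xs = 0"
    and "\<forall>j<q. (\<Sum>xs\<leftarrow>M. xs ! j) = 0" and "S \<subseteq> set (concat M)"
  shows "zero_sum_array p q S"
  unfolding zero_sum_array_def
proof (rule exI[of _ "\<lambda>i j. M ! i ! j"], intro conjI allI impI ballI)
  fix i assume "i < p"
  then have "M ! i \<in> set M" using assms(1) by simp
  then have "length (M ! i) = q" "sum_list (M ! i) = 0" using assms(2) by auto
  then show "(\<Sum>j<q. M ! i ! j) = 0" by (simp add: sum_list_sum_nth atLeast0LessThan)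
next
  fix j assume "j < q"
  then have "(\<Sum>xs\<leftarrow>M. xs ! j) = 0" using assms(3) by blast
  then show "(\<Sum>i<p. M ! i ! j) = 0"
    using assms(1) by (simp add: sum_list_sum_nth atLeast0LessThan)
next
  fix x assume "x \<in> S"
  then obtain xs where "xs \<in> set M" "x \<in> set xs" using assms(4) by auto
  then show "\<exists>i<p. \<exists>j<q. M ! i ! j = x"
    using assms(1,2) by (metis in_set_conv_nth)
qed

lemma zero_sum_array_bij_betw:
  assumes "zero_sum_array p q S" "card S = p * q"
  obtains f where "bij_betw (\<lambda>(i, j). f i j) ({..<p} \<times> {..<q}) S"
    "\<And>i. i < p \<Longrightarrow> (\<Sum>j<q. f i j) = 0" "\<And>j. j < q \<Longrightarrow> (\<Sum>i<p. f i j) = 0"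
proof -
  obtain f where f: "\<forall>i<p. (\<Sum>j<q. f i j) = 0" "\<forall>j<q. (\<Sum>i<p. f i j) = 0"
      "\<forall>x\<in>S. \<exists>i<p. \<exists>j<q. f i j = x"
    using assms(1) unfolding zero_sum_array_def by blast
  let ?f = "\<lambda>(i, j). f i j" and ?D = "{..<p} \<times> {..<q}"
  have "card (?f ` ?D) \<le> card S"
    using card_image_le[of ?D ?f] assms(2) by (simp add: card_cartesian_product)
  moreover have "S \<subseteq> ?f ` ?D" using f(3) by force
  ultimately have "S = ?f ` ?D" by (intro card_seteq) auto
  moreover from this have "inj_on ?f ?D" using assms(2) by (intro eq_card_imp_inj_on) auto
  ultimately have "bij_betw ?f ?D S" unfolding bij_betw_def by blast
  then show ?thesis using that f(1,2) by blast
qed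

section \<open>Symmetric sets of entries\<close>

definition plus_minus :: "'a::group_add set \<Rightarrow> 'a set" where
  "plus_minus A = A \<union> uminus ` A"

definition progression :: "'a::comm_ring_1 \<Rightarrow> 'a \<Rightarrow> nat \<Rightarrow> 'a set" where
  "progression a s n = (\<lambda>k. a + of_nat k * s) ` {..<n}"

lemma plus_minus_Un: "plus_minus (A \<union> B) = plus_minus A \<union> plus_minus B"
  unfolding plus_minus_def by auto

lemma plus_minus_mono: "A \<subseteq> B \<Longrightarrow> plus_minus A \<subseteq> plus_minus B"
  unfolding plus_minus_def by auto

lemma plus_minus_atLeastAtMost: "plus_minus {0..int n} = {- int n..int n}"
  unfolding plus_minus_def by auto

lemma progression_0: "progression a s 0 = {}"
  by (simp add: progression_def)

lemma progression_add:
  "progression a s (m + n) = progression a s m \<union> progression (a + of_nat m * s) s n"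
proof -
  have "{..<m + n} = {..<m} \<union> (+) m ` {..<n}"
    using image_add_atLeastLessThan[of m 0 n] by (auto simp: atLeast0LessThan)
  then show ?thesis by (simp add: progression_def image_Un image_image algebra_simps)
qed

lemma progression_step_one: "progression a 1 n = {a..<a + int n}"
proof -
  have "{a..<a + int n} = (\<lambda>k. a + k) ` int ` {..<n}"
    by (simp add: image_int_atLeastLessThan flip: atLeast0LessThan add.commute)
  then show ?thesis by (simp add: progression_def image_image)
qed

lemma zero_sum_array_two_four: "zero_sum_array 2 4 (plus_minus (progression a s 4))"
proof -
  let ?M = "[[a, - (a + s), - (a + 2 * s), a + 3 * s], [- a, a + s, a + 2 * s, - (a + 3 * s)]]"
  show ?thesis
    by (rule zero_sum_array_of_lists[of ?M])
      (auto simp: plus_minus_def progression_def numeral_eq_Suc less_Suc_eq lessThan_Suc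
        algebra_simps)
qed

lemma zero_sum_array_repeat:
  assumes "\<And>a. zero_sum_array p q (plus_minus (progression a s n))"
  shows "zero_sum_array p (l * q) (plus_minus (progression a s (l * n)))"
proof (induction l arbitrary: a)
  case 0
  then show ?case by (simp add: zero_sum_array_def plus_minus_def progression_0)
next
  case (Suc l)
  from zero_sum_array_beside[OF assms Suc]
  show ?case by (simp add: progression_add plus_minus_Un)
qed

lemma zero_sum_array_even:
  assumes "even p" "even q" "4 dvd p \<or> 4 dvd q"
  shows "zero_sum_array p q (plus_minus (progression a s (p * q div 2)))"
proof -
  have tiled: "zero_sum_array x y (plus_minus (progression a s (x * y div 2)))"
    if x: "even x" and y: "4 dvd y" for x y
  proof -
    obtain k l where kl: "x = k * 2" "y = l * 4" using x y by (metis dvd_def mult.commute)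
    have "zero_sum_array 2 y (plus_minus (progression a s y))" for a
      unfolding kl by (intro zero_sum_array_repeat zero_sum_array_two_four)
    then have "zero_sum_array y 2 (plus_minus (progression a s y))" for a
      by (rule zero_sum_array_transpose)
    then have "zero_sum_array y x (plus_minus (progression a s (k * y)))"
      unfolding kl(1) by (rule zero_sum_array_repeat)
    then show ?thesis using zero_sum_array_transpose by (fastforce simp: kl(1))
  qed
  show ?thesis
    using assms tiled[of p q] tiled[of q p] zero_sum_array_transpose by (metis mult.commute)
qed

lemma zero_sum_array_two_rows_odd_numbers:
  assumes "6 \<le> q" "q mod 4 = 2"
  shows "zero_sum_array 2 q (plus_minus (progression (1 :: int) 2 q))"
proof -
  let ?M = "[[11, 7, -9, -5, -3, -1], [-11, -7, 9, 5, 3, 1 :: int]]"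
  have "zero_sum_array 2 6 (plus_minus (progression (1 :: int) 2 6))"
    by (rule zero_sum_array_of_lists[of ?M])
      (auto simp: plus_minus_def progression_def numeral_eq_Suc less_Suc_eq lessThan_Suc)
  moreover have "4 dvd q - 6" "even (q - 6)" using assms by presburger+
  then have "zero_sum_array 2 (q - 6) (plus_minus (progression 13 (2 :: int) (q - 6)))"
    using zero_sum_array_even[of 2 "q - 6" "13 :: int" 2] by simp
  ultimately have "zero_sum_array 2 (6 + (q - 6))
      (plus_minus (progression (1 :: int) 2 (6 + (q - 6))))"
    unfolding progression_add plus_minus_Un by (intro zero_sum_array_beside) simp_all
  then show ?thesis using assms(1) by simp
qed

lemma zero_sum_array_odd_numbers:
  assumes "even p" "even q" "\<not> (p = 2 \<and> q = 2)"
  shows "zero_sum_array p q (plus_minus (progression (1 :: int) 2 (p * q div 2)))"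
proof (cases "4 dvd p \<or> 4 dvd q")
  case True
  then show ?thesis using assms zero_sum_array_even by blast
next
  case False
  have tall: "zero_sum_array x y (plus_minus (progression (1 :: int) 2 (x * y div 2)))"
    if xy: "x mod 4 = 2" "y mod 4 = 2" "6 \<le> y" for x y
  proof -
    have "2 \<le> x" "4 dvd x - 2" "even y" using xy by presburger+
    then have "zero_sum_array 2 y (plus_minus (progression (1 :: int) 2 y))"
      "zero_sum_array (x - 2) y (plus_minus (progression (1 + int y * 2) 2 ((x - 2) * y div 2)))"
      using xy by (auto intro!: zero_sum_array_two_rows_odd_numbers zero_sum_array_even
          intro: dvd_trans[of 2 4])
    then have "zero_sum_array (2 + (x - 2)) y
        (plus_minus (progression (1 :: int) 2 (y + (x - 2) * y div 2)))"
      unfolding progression_add plus_minus_Un by (intro zero_sum_array_above) simp_all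
    moreover have "y + (x - 2) * y div 2 = x * y div 2"
      using \<open>2 \<le> x\<close> by (auto simp: le_iff_add algebra_simps)
    ultimately show ?thesis using \<open>2 \<le> x\<close> by (simp only: le_add_diff_inverse)
  qed
  have "p mod 4 = 2" "q mod 4 = 2" using False assms(1,2) by presburger+
  moreover from this have "6 \<le> q \<or> 6 \<le> p" using assms(3) by presburger
  ultimately show ?thesis
    using tall[of p q] tall[of q p] zero_sum_array_transpose by (metis mult.commute)
qed

section \<open>Zero-sum arrays with odd sides\<close>

lemma zero_sum_array_triples:
  assumes "finite I" "\<And>i. i \<in> I \<Longrightarrow> a i + b i = (c i :: 'a::ab_group_add)"
  shows "zero_sum_array 3 (2 * card I) (plus_minus (\<Union>i\<in>I. {a i, b i, c i}))"
  using assms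
proof (induction I rule: finite_induct)
  case empty
  then show ?case by (simp add: zero_sum_array_def plus_minus_def)
next
  case (insert x I)
  let ?M = "[[a x, - a x], [b x, - b x], [- c x, c x]]"
  have "zero_sum_array 3 2 (plus_minus {a x, b x, c x})"
    using insert.prems[of x]
    by (intro zero_sum_array_of_lists[of ?M])
      (auto simp: plus_minus_def numeral_eq_Suc less_Suc_eq algebra_simps)
  from zero_sum_array_beside[OF this insert.IH] insert show ?case
    by (simp flip: plus_minus_Un)
qed

text \<open>
  The triples \<open>i + middle u w i = c\<close>, with \<open>i \<in> differences u w\<close>, nest the remaining members as
  pairs in \<open>u + w + 1, \<dots>, 3(u + w) + 1\<close>; the even differences are nested around \<open>center u w\<close>,
  the one number that stays unpaired.
\<close>

definition center :: "nat \<Rightarrow> nat \<Rightarrow> int" where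
  "center u w = 3 * int u + 2 * int w + 1"

definition middle :: "nat \<Rightarrow> nat \<Rightarrow> nat \<Rightarrow> int" where
  "middle u w i = (if even i then center u w else 2 * int u + int w) - int (i div 2)"

definition differences :: "nat \<Rightarrow> nat \<Rightarrow> nat set" where
  "differences u w = {i. 1 \<le> i \<and> i \<le> (if even i then 2 * w else 2 * u)}"

definition triple :: "nat \<Rightarrow> nat \<Rightarrow> nat \<Rightarrow> int set" where
  "triple u w i = {int i, middle u w i, int i + middle u w i}"

lemma triple_even: "triple u w (2 * k) = {2 * int k, center u w - int k, center u w + int k}"
  by (auto simp: triple_def middle_def)

lemma triple_odd:
  "triple u w (2 * k + 1) =
     {2 * int k + 1, 2 * int u + int w - int k, 2 * int u + int w + int k + 1}"
  by (auto simp: triple_def middle_def)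

lemma interval_cover_by_nested_pairs:
  "{0..3 * int (u + w) + 1} \<subseteq>
     {0, center u w} \<union> int ` {1..u + w} \<union> (\<Union>i\<in>differences u w. triple u w i)"
proof
  fix z assume z: "z \<in> {0..3 * int (u + w) + 1}"
  have odd_in: "2 * k + 1 \<in> differences u w" if "k < u" for k
    using that by (simp add: differences_def)
  have even_in: "2 * k \<in> differences u w" if "1 \<le> k" "k \<le> w" for k
    using that by (simp add: differences_def)
  consider "z = 0 \<or> z = center u w" | "1 \<le> z" "z \<le> int (u + w)"
    | "int (u + w) < z" "z \<le> 2 * int u + int w"
    | "2 * int u + int w < z" "z \<le> 3 * int u + int w"
    | "3 * int u + int w < z" "z \<noteq> center u w" using z by fastforce
  then show "z \<in> {0, center u w} \<union> int ` {1..u + w} \<union> (\<Union>i\<in>differences u w. triple u w i)"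
  proof cases
    case 1
    then show ?thesis by blast
  next
    case 2
    then have "z = int (nat z)" "nat z \<in> {1..u + w}" by auto
    then show ?thesis by blast
  next
    case 3
    define k where "k = nat (2 * int u + int w - z)"
    then have "k < u" "z \<in> triple u w (2 * k + 1)" using 3 unfolding triple_odd by auto
    then show ?thesis using odd_in by blast
  next
    case 4
    define k where "k = nat (z - 2 * int u - int w - 1)"
    then have "k < u" "z \<in> triple u w (2 * k + 1)" using 4 unfolding triple_odd by auto
    then show ?thesis using odd_in by blast
  next
    case 5
    define k where "k = nat \<bar>z - center u w\<bar>"
    then have "1 \<le> k" "k \<le> w" "z \<in> triple u w (2 * k)"
      using 5 z unfolding triple_even by (auto simp: center_def)
    then show ?thesis using even_in by blast
  qed
qed

lemma interval_cover_by_triples: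
  assumes "u = w \<or> u = Suc w"
  shows "{0..3 * int (u + w) + 1} \<subseteq> {0, center u w} \<union> (\<Union>i\<in>{1..u + w}. triple u w i)"
proof -
  have "differences u w \<subseteq> {1..u + w}"
    using assms unfolding differences_def by (auto split: if_splits) presburger
  then have "(\<Union>i\<in>differences u w. triple u w i) \<subseteq> (\<Union>i\<in>{1..u + w}. triple u w i)"
    by (rule UN_mono) simp
  moreover have "int ` {1..u + w} \<subseteq> (\<Union>i\<in>{1..u + w}. triple u w i)"
    by (auto simp: triple_def)
  ultimately show ?thesis
    by (intro order_trans[OF interval_cover_by_nested_pairs]) blast
qed

text \<open>
  The column \<open>(-v, 0, v)\<close> is balanced by the triples \<open>(2k, v - k, v + k)\<close> with \<open>k = 1, 2, 3\<close>: the
  columns of such a triple and of its negative, with two entries exchanged, contribute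
  \<open>v + 3\<close>, \<open>-(v - 6)\<close> and \<open>v - 9\<close> to the first row.
\<close>

lemma zero_sum_array_core:
  "zero_sum_array 3 7 (plus_minus ({0, v} \<union> (\<Union>k\<in>{1, 2, 3 :: int}. {2 * k, v - k, v + k})))"
proof -
  let ?M = "[[-v, v - 3, -6, 2, v + 1, 4, -(v - 2)],
             [0, -(v + 3), v + 3, v - 1, -(v - 1), -(v + 2), v + 2],
             [v, 6, -(v - 3), -(v + 1), -2, v - 2, -4]]"
  show ?thesis
    by (rule zero_sum_array_of_lists[of ?M]) (auto simp: plus_minus_def numeral_eq_Suc less_Suc_eq)
qed

lemma zero_sum_array_core_and_arms:
  assumes "finite I" "{2, 4, 6} \<subseteq> I" "card I = 3 + x + y"
  obtains S T where "zero_sum_array 3 (7 + 2 * x) S" "zero_sum_array (2 * y) 3 T"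
    "S \<union> T = plus_minus ({0, center u w} \<union> (\<Union>i\<in>I. triple u w i))"
proof -
  define A where "A J = plus_minus (\<Union>i\<in>J. triple u w i)" for J
  have strip: "zero_sum_array 3 (2 * card J) (A J)" if "finite J" for J
    unfolding A_def triple_def using that by (intro zero_sum_array_triples) auto
  have "card (I - {2, 4, 6}) = x + y" using assms by (subst card_Diff_subset) auto
  then obtain J where J: "J \<subseteq> I - {2, 4, 6}" "card J = x"
    using obtain_subset_with_card_n[of x "I - {2, 4, 6}"] by auto
  define J' where "J' = I - {2, 4, 6} - J"
  have fin: "finite J" "finite J'"
    using J(1) assms(1) unfolding J'_def by (auto intro: finite_subset)
  have "card J' = y"
    unfolding J'_def using J fin(1) \<open>card (I - {2, 4, 6}) = x + y\<close> by (subst card_Diff_subset) auto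
  define K where
    "K = {0, center u w} \<union> (\<Union>k\<in>{1, 2, 3}. {2 * k, center u w - k, center u w + k})"
  have "zero_sum_array 3 (7 + 2 * x) (plus_minus K \<union> A J)"
    unfolding K_def using strip[OF fin(1)] J(2)
    by (intro zero_sum_array_beside zero_sum_array_core) simp
  moreover have "zero_sum_array (2 * y) 3 (A J')"
    using strip[OF fin(2)] \<open>card J' = y\<close> by (auto intro: zero_sum_array_transpose)
  moreover have "(plus_minus K \<union> A J) \<union> A J' =
      plus_minus ({0, center u w} \<union> (\<Union>i\<in>I. triple u w i))"
  proof -
    have "K = {0, center u w} \<union> (\<Union>i\<in>{2, 4, 6}. triple u w i)"
      unfolding K_def using triple_even[of u w 1] triple_even[of u w 2] triple_even[of u w 3]
      by simp
    moreover have "I = {2, 4, 6} \<union> J \<union> J'" using J(1) assms(2) unfolding J'_def by blast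
    ultimately show ?thesis unfolding A_def by (simp only: UN_Un plus_minus_Un Un_assoc)
  qed
  ultimately show ?thesis by (rule that)
qed

lemma zero_sum_array_with_even_arm:
  assumes "3 \<le> x + y" "even x \<or> even y"
  shows "zero_sum_array (3 + 2 * y) (7 + 2 * x)
    (plus_minus {0..int ((3 + 2 * y) * (7 + 2 * x) div 2)})"
proof -
  define h u w where "h = x + y + 3" and "u = (h + 1) div 2" and "w = h div 2"
  define n where "n = 2 * y * (4 + 2 * x) div 2"
  define C where "C = progression (3 * int h + 2) 1 n"
  have h: "h = u + w" unfolding u_def w_def by presburger
  obtain S T where S: "zero_sum_array 3 (7 + 2 * x) S" and T: "zero_sum_array (2 * y) 3 T"
    and ST: "S \<union> T = plus_minus ({0, center u w} \<union> (\<Union>i\<in>{1..h}. triple u w i))"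
    by (rule zero_sum_array_core_and_arms[of "{1..h}" x y u w]) (use assms in \<open>auto simp: h_def\<close>)
  have "zero_sum_array (2 * y) (4 + 2 * x) (plus_minus C)"
    unfolding C_def n_def using assms(2) by (intro zero_sum_array_even) auto
  from zero_sum_array_beside[OF T this]
  have "zero_sum_array (2 * y) (7 + 2 * x) (T \<union> plus_minus C)" by (simp add: algebra_simps)
  with S have "zero_sum_array (3 + 2 * y) (7 + 2 * x) (S \<union> (T \<union> plus_minus C))"
    by (rule zero_sum_array_above)
  moreover have "plus_minus {0..int ((3 + 2 * y) * (7 + 2 * x) div 2)} \<subseteq> S \<union> (T \<union> plus_minus C)"
  proof -
    have "(3 + 2 * y) * (7 + 2 * x) div 2 = 3 * h + 1 + n"
      unfolding n_def h_def by (simp add: algebra_simps)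
    then have "{0..int ((3 + 2 * y) * (7 + 2 * x) div 2)} \<subseteq> {0..3 * int h + 1} \<union> C"
      unfolding C_def progression_step_one by auto
    moreover have "{0..3 * int h + 1} \<subseteq> {0, center u w} \<union> (\<Union>i\<in>{1..h}. triple u w i)"
      unfolding h by (intro interval_cover_by_triples) (auto simp: u_def w_def)
    ultimately show ?thesis
      unfolding Un_assoc[symmetric] ST plus_minus_Un[symmetric] by (intro plus_minus_mono) blast
  qed
  ultimately show ?thesis by (rule zero_sum_array_mono)
qed

text \<open>
  If both \<open>x\<close> and \<open>y\<close> are odd, the region outside the two arms has both sides congruent to 2
  modulo 4, so \<open>2 \<times> 4\<close> blocks do not tile it. Using the differences \<open>1, \<dots>, h - 1, h + 1\<close> with
  \<open>h = 2u + 1\<close> instead, the number \<open>h\<close> fails the triple of \<open>h + 1\<close> by one, which the consecutive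
  numbers \<open>3h + 2, 3h + 3\<close> compensate.
\<close>

lemma zero_sum_array_two_five:
  "zero_sum_array 2 5 (plus_minus {2 * u + 1, 4 * u + 2, 6 * u + 4, 6 * u + 5, 6 * u + 6 :: int})"
proof -
  let ?M = "[[2 * u + 1, 4 * u + 2, - (6 * u + 4), - (6 * u + 5), 6 * u + 6],
             [- (2 * u + 1), - (4 * u + 2), 6 * u + 4, 6 * u + 5, - (6 * u + 6)]]"
  show ?thesis
    by (rule zero_sum_array_of_lists[of ?M]) (auto simp: plus_minus_def numeral_eq_Suc less_Suc_eq)
qed

lemma interval_cover_omitting_one_triple:
  assumes "1 \<le> u"
  shows "{0..6 * int u + 4} \<subseteq> {0, center u (Suc u)} \<union> (\<Union>i\<in>{1..2 * u}. triple u (Suc u) i) \<union>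
    {2 * int u + 1, 4 * int u + 2, 6 * int u + 4}"
proof -
  define A where "A = (\<Union>i\<in>{1..2 * u}. triple u (Suc u) i)"
  define E where "E = {2 * int u + 1, 4 * int u + 2, 6 * int u + 4}"
  have "2 * int u + 2 \<in> A"
    unfolding A_def using assms triple_odd[of u "Suc u" "u - 1"]
    by (intro UN_I[of "2 * (u - 1) + 1"]) (auto simp: of_nat_diff)
  moreover have "triple u (Suc u) (2 * Suc u) = {2 * int u + 2, 4 * int u + 2, 6 * int u + 4}"
    unfolding triple_even by (auto simp: center_def)
  ultimately have "triple u (Suc u) (2 * Suc u) \<subseteq> A \<union> E" unfolding E_def by simp
  moreover have "differences u (Suc u) \<subseteq> insert (2 * Suc u) {1..2 * u}"
    unfolding differences_def by (auto split: if_splits elim!: evenE)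
  ultimately have pairs: "(\<Union>i\<in>differences u (Suc u). triple u (Suc u) i) \<subseteq> A \<union> E"
    unfolding A_def by blast
  have small: "int ` {1..u + Suc u} \<subseteq> A \<union> E"
  proof
    fix z assume "z \<in> int ` {1..u + Suc u}"
    then obtain i where i: "z = int i" "i \<in> {1..u + Suc u}" by blast
    then have "z \<in> triple u (Suc u) i" by (simp add: triple_def)
    moreover have "i \<in> {1..2 * u} \<or> i = 2 * u + 1" using i(2) by auto
    ultimately show "z \<in> A \<union> E" using i(1) unfolding A_def E_def by auto
  qed
  have "{0..6 * int u + 4} = {0..3 * int (u + Suc u) + 1}" by auto
  also have "\<dots> \<subseteq> {0, center u (Suc u)} \<union> A \<union> E"
    using pairs small by (intro order_trans[OF interval_cover_by_nested_pairs]) blast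
  finally show ?thesis unfolding A_def E_def .
qed

lemma zero_sum_array_lower_rows:
  assumes F: "zero_sum_array 2 5 (plus_minus F)" and T: "zero_sum_array (2 * z) 3 T"
    and "odd x" "even z"
  shows "zero_sum_array (2 + 2 * z) (7 + 2 * x)
    (T \<union> plus_minus (F \<union> progression a s (2 + 2 * x + z * (4 + 2 * x))))"
proof -
  define B where "B = progression a s (2 + 2 * x)"
  define C where "C = progression (a + of_nat (2 + 2 * x) * s) s (z * (4 + 2 * x))"
  have "4 dvd 2 + 2 * x" using assms(3) by presburger
  then have "zero_sum_array 2 (2 + 2 * x) (plus_minus B)"
    using zero_sum_array_even[of 2 "2 + 2 * x" a s] unfolding B_def by simp
  from zero_sum_array_beside[OF F this]
  have "zero_sum_array 2 (7 + 2 * x) (plus_minus F \<union> plus_minus B)" by simp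
  moreover have "zero_sum_array (2 * z) (4 + 2 * x) (plus_minus C)"
    using zero_sum_array_even[of "2 * z" "4 + 2 * x" "a + of_nat (2 + 2 * x) * s" s] assms(4)
    unfolding C_def by (simp add: mult.assoc)
  from zero_sum_array_beside[OF T this]
  have "zero_sum_array (2 * z) (7 + 2 * x) (T \<union> plus_minus C)" by (simp add: algebra_simps)
  ultimately have "zero_sum_array (2 + 2 * z) (7 + 2 * x)
      ((plus_minus F \<union> plus_minus B) \<union> (T \<union> plus_minus C))"
    by (rule zero_sum_array_above)
  moreover have "T \<union> plus_minus (F \<union> progression a s (2 + 2 * x + z * (4 + 2 * x))) =
      (plus_minus F \<union> plus_minus B) \<union> (T \<union> plus_minus C)"
    unfolding progression_add[of a s "2 + 2 * x"] B_def C_def plus_minus_Un by blast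
  ultimately show ?thesis by simp
qed

lemma zero_sum_array_with_odd_arms:
  assumes "3 \<le> x + z" "odd x" "even z"
  shows "zero_sum_array (3 + 2 * Suc z) (7 + 2 * x)
    (plus_minus {0..int ((3 + 2 * Suc z) * (7 + 2 * x) div 2)})"
proof -
  define u where "u = (x + z + 3) div 2"
  have u: "2 * u = x + z + 3" "1 \<le> u" "6 \<le> 2 * u" using assms unfolding u_def by auto
  define F where "F = {2 * int u + 1, 4 * int u + 2, 6 * int u + 4, 6 * int u + 5, 6 * int u + 6}"
  define P where "P = progression (6 * int u + 7) 1 (2 + 2 * x + z * (4 + 2 * x))"
  obtain S T where S: "zero_sum_array 3 (7 + 2 * x) S" and T: "zero_sum_array (2 * z) 3 T"
    and ST: "S \<union> T =
      plus_minus ({0, center u (Suc u)} \<union> (\<Union>i\<in>{1..2 * u}. triple u (Suc u) i))"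
    by (rule zero_sum_array_core_and_arms[of "{1..2 * u}" x z u "Suc u"]) (use u in auto)
  have "zero_sum_array (2 + 2 * z) (7 + 2 * x) (T \<union> plus_minus (F \<union> P))"
    unfolding F_def P_def using assms(2,3)
    by (intro zero_sum_array_lower_rows zero_sum_array_two_five T)
  with S have "zero_sum_array (3 + (2 + 2 * z)) (7 + 2 * x) (S \<union> (T \<union> plus_minus (F \<union> P)))"
    by (rule zero_sum_array_above)
  moreover have "plus_minus {0..int ((3 + 2 * Suc z) * (7 + 2 * x) div 2)} \<subseteq>
      S \<union> (T \<union> plus_minus (F \<union> P))"
  proof -
    have "(3 + 2 * Suc z) * (7 + 2 * x) div 2 = 6 * u + 6 + (2 + 2 * x + z * (4 + 2 * x))"
      using u(1) by (simp add: algebra_simps)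
    then have "{0..int ((3 + 2 * Suc z) * (7 + 2 * x) div 2)} \<subseteq> {0..6 * int u + 4} \<union> F \<union> P"
      unfolding P_def F_def progression_step_one by auto
    moreover have "{0..6 * int u + 4} \<subseteq>
        {0, center u (Suc u)} \<union> (\<Union>i\<in>{1..2 * u}. triple u (Suc u) i) \<union> F"
      using interval_cover_omitting_one_triple[OF u(2)] unfolding F_def by blast
    ultimately show ?thesis
      unfolding Un_assoc[symmetric] ST plus_minus_Un[symmetric] by (intro plus_minus_mono) blast
  qed
  ultimately show ?thesis using zero_sum_array_mono by simp
qed

lemma zero_sum_array_interval_of_lists:
  fixes x :: int
  assumes "length M = p" "\<forall>xs\<in>set M. length xs = q \<and> sum_list xs = 0"
    and "\<forall>j<q. (\<Sum>xs\<leftarrow>M. xs ! j) = 0" "set [-x..x] \<subseteq> set (concat M)"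
  shows "zero_sum_array p q {-x..x}"
  using assms by (intro zero_sum_array_of_lists[of M]) simp_all

lemma zero_sum_array_three_rows_small:
  "zero_sum_array 3 3 {-4..4 :: int}"
  "zero_sum_array 3 5 {-7..7 :: int}"
  "zero_sum_array 3 7 {-10..10 :: int}"
  "zero_sum_array 3 9 {-13..13 :: int}"
  "zero_sum_array 3 11 {-16..16 :: int}"
proof -
  show "zero_sum_array 3 3 {-4..4 :: int}"
    by (rule zero_sum_array_interval_of_lists[where M =
      "[[3, -4, 1], [-2, 0, 2], [-1, 4, -3]]"]; code_simp)
  show "zero_sum_array 3 5 {-7..7 :: int}"
    by (rule zero_sum_array_interval_of_lists[where M =
      "[[6, 2, -4, -3, -1], [-7, -5, 0, 5, 7], [1, 3, 4, -2, -6]]"];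
      code_simp)
  show "zero_sum_array 3 7 {-10..10 :: int}"
    by (rule zero_sum_array_interval_of_lists[where M =
      "[[6, 9, -2, -3, -7, 1, -4], [-10, -8, -5, 0, 5, 8, 10],
      [4, -1, 7, 3, 2, -9, -6]]"]; code_simp)
  show "zero_sum_array 3 9 {-13..13 :: int}"
    by (rule zero_sum_array_interval_of_lists[where M =
      "[[-2, -8, 6, -12, 5, -3, 10, -7, 11],
      [13, 1, 4, 9, 0, -9, -4, -1, -13], [-11, 7, -10, 3, -5, 12, -6, 8, 2]]"]; code_simp)
  show "zero_sum_array 3 11 {-16..16 :: int}"
    by (rule zero_sum_array_interval_of_lists[where M =
      "[[15, -14, -10, -2, 16, -8, 5, -9, -4, -1, 12],
      [-3, 13, 6, -7, -11, 0, 11, 7, -6, -13, 3], [-12, 1, 4, 9, -5, 8, -16, 2, 10, 14, -15]]"];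
      code_simp)
qed

lemma zero_sum_array_five_rows_small:
  "zero_sum_array 5 5 {-12..12 :: int}"
  "zero_sum_array 5 7 {-17..17 :: int}"
  "zero_sum_array 5 9 {-22..22 :: int}"
proof -
  show "zero_sum_array 5 5 {-12..12 :: int}"
    by (rule zero_sum_array_interval_of_lists[where M =
      "[[4, 11, -12, -5, 2], [10, -8, -6, 1, 3], [-9, -7, 0, 7, 9],
      [-3, -1, 6, 8, -10], [-2, 5, 12, -11, -4]]"]; code_simp)
  show "zero_sum_array 5 7 {-17..17 :: int}"
    by (rule zero_sum_array_interval_of_lists[where M =
      "[[6, -2, -7, -16, 12, 15, -8], [5, 14, -11, 3, -17, -4, 10],
      [-9, -1, 13, 0, -13, 1, 9], [-10, 4, 17, -3, 11, -14, -5], [8, -15, -12, 16, 7, 2, -6]]"];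
      code_simp)
  show "zero_sum_array 5 9 {-22..22 :: int}"
    by (rule zero_sum_array_interval_of_lists[where M =
      "[[-9, -15, 6, -2, 3, 22, 18, -13, -10],
      [-14, 19, -7, 21, -16, 8, 1, 5, -17], [-4, -12, 20, 11, 0, -11, -20, 12, 4],
      [17, -5, -1, -8, 16, -21, 7, -19, 14], [10, 13, -18, -22, -3, 2, -6, 15, 9]]"]; code_simp)
qed

lemma zero_sum_array_seven_seven:
  "zero_sum_array 7 7 {-24..24 :: int}"
  by (rule zero_sum_array_interval_of_lists[where M =
    "[[5, 14, 23, -24, -15, -6, 3], [13, 22, -18, -16, -7, 2, 4],
    [21, -19, -17, -8, 1, 10, 12], [-20, -11, -9, 0, 9, 11, 20], [-12, -10, -1, 8, 17, 19, -21],
    [-4, -2, 7, 16, 18, -22, -13], [-3, 6, 15, 24, -23, -14, -5]]"]; code_simp)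

lemmas zero_sum_array_odd_sides_small =
  zero_sum_array_three_rows_small zero_sum_array_five_rows_small zero_sum_array_seven_seven

lemma zero_sum_array_odd_ordered:
  assumes "odd p" "odd q" "3 \<le> p" "p \<le> q"
  shows "zero_sum_array p q {- int (p * q div 2)..int (p * q div 2)}"
proof (cases "q \<le> 5")
  case True
  then have "(p, q) \<in> {(3, 3), (3, 5), (5, 5)}" using assms by simp presburger
  then show ?thesis using zero_sum_array_odd_sides_small by auto
next
  case False
  have "\<exists>x y. q = 7 + 2 * x \<and> p = 3 + 2 * y" using assms False by presburger
  then obtain x y where q: "q = 7 + 2 * x" and p: "p = 3 + 2 * y" by blast
  show ?thesis
  proof (cases "x + y < 3")
    case True
    then have "(y, x) \<in> {(0, 0), (0, 1), (0, 2), (1, 0), (1, 1), (2, 0)}"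
      using assms(4) unfolding p q by simp presburger
    then show ?thesis using zero_sum_array_odd_sides_small unfolding p q by auto
  next
    case big: False
    show ?thesis
    proof (cases "even x \<or> even y")
      case True
      with big show ?thesis
        using zero_sum_array_with_even_arm[of x y] unfolding p q plus_minus_atLeastAtMost by simp
    next
      case False
      then obtain z where z: "y = Suc z" by (cases y) auto
      then have "3 \<le> x + z" "odd x" "even z" using False big by presburger+
      then show ?thesis
        using zero_sum_array_with_odd_arms[of x z] unfolding p q z plus_minus_atLeastAtMost by simp
    qed
  qed
qed

lemma zero_sum_array_odd:
  assumes "odd p" "odd q" "3 \<le> p" "3 \<le> q"
  shows "zero_sum_array p q {- int (p * q div 2)..int (p * q div 2)}"
proof (cases "p \<le> q")
  case True
  with assms show ?thesis by (intro zero_sum_array_odd_ordered)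
next
  case False
  with assms have "zero_sum_array q p {- int (q * p div 2)..int (q * p div 2)}"
    by (intro zero_sum_array_odd_ordered) auto
  then show ?thesis by (simp add: zero_sum_array_transpose mult.commute)
qed

section \<open>Magic rectangles\<close>

definition magic_rectangle :: "nat \<Rightarrow> nat \<Rightarrow> (nat \<Rightarrow> nat \<Rightarrow> nat) \<Rightarrow> bool" where
  "magic_rectangle p q M \<longleftrightarrow>
     bij_betw (\<lambda>(i, j). M i j) ({..<p} \<times> {..<q}) {1..p * q} \<and>
     (\<forall>i<p. 2 * (\<Sum>j<q. M i j) = q * (p * q + 1)) \<and>
     (\<forall>j<q. 2 * (\<Sum>i<p. M i j) = p * (p * q + 1))"

definition centered :: "nat \<Rightarrow> nat \<Rightarrow> int" where
  "centered n k = 2 * int k - int (n + 1)"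

lemma inj_centered: "inj (centered n)"
  by (simp add: inj_on_def centered_def)

lemma sum_centered_eq_0_iff:
  "(\<Sum>i\<in>I. centered n (g i)) = 0 \<longleftrightarrow> 2 * (\<Sum>i\<in>I. g i) = card I * (n + 1)"
proof -
  have "(\<Sum>i\<in>I. centered n (g i)) = int (2 * (\<Sum>i\<in>I. g i)) - int (card I * (n + 1))"
    by (simp add: centered_def sum_subtractf sum_distrib_left algebra_simps)
  then show ?thesis by (simp only: right_minus_eq of_nat_eq_iff)
qed

lemma magic_rectangle_of_zero_sum_array:
  assumes "zero_sum_array p q (centered (p * q) ` {1..p * q})"
  obtains M where "magic_rectangle p q M"
proof -
  let ?\<phi> = "centered (p * q)"
  have \<phi>: "bij_betw ?\<phi> {1..p * q} (?\<phi> ` {1..p * q})"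
    by (intro inj_on_imp_bij_betw inj_on_subset[OF inj_centered]) simp
  have "card (?\<phi> ` {1..p * q}) = p * q" using bij_betw_same_card[OF \<phi>] by simp
  with assms obtain f where f: "bij_betw (\<lambda>(i, j). f i j) ({..<p} \<times> {..<q}) (?\<phi> ` {1..p * q})"
    "\<And>i. i < p \<Longrightarrow> (\<Sum>j<q. f i j) = 0" "\<And>j. j < q \<Longrightarrow> (\<Sum>i<p. f i j) = 0"
    by (rule zero_sum_array_bij_betw) blast
  define M where "M i j = inv_into {1..p * q} ?\<phi> (f i j)" for i j
  have M: "?\<phi> (M i j) = f i j" if "i < p" "j < q" for i j
    unfolding M_def using bij_betwE[OF f(1)] that by (intro f_inv_into_f) force
  have "bij_betw (\<lambda>(i, j). M i j) ({..<p} \<times> {..<q}) {1..p * q}"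
    using bij_betw_trans[OF f(1) bij_betw_inv_into[OF \<phi>]]
    by (simp add: M_def comp_def case_prod_unfold)
  moreover have "2 * (\<Sum>j<q. M i j) = q * (p * q + 1)" if "i < p" for i
    using sum_centered_eq_0_iff[of "p * q" "M i" "{..<q}"] f(2)[OF that] M[OF that] by simp
  moreover have "2 * (\<Sum>i<p. M i j) = p * (p * q + 1)" if "j < q" for j
    using sum_centered_eq_0_iff[of "p * q" "\<lambda>i. M i j" "{..<p}"] f(3)[OF that] M that by simp
  ultimately show ?thesis using that unfolding magic_rectangle_def by blast
qed

lemma centered_image_even:
  assumes "even n"
  shows "centered n ` {1..n} \<subseteq> plus_minus (progression 1 2 (n div 2))"
proof
  fix x assume "x \<in> centered n ` {1..n}"
  then obtain k where k: "k \<in> {1..n}" "x = centered n k" by blast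
  obtain l where l: "n = 2 * l" using assms by blast
  show "x \<in> plus_minus (progression 1 2 (n div 2))"
  proof (cases "k \<le> l")
    case True
    then have "- x = 1 + of_nat (l - k) * 2" "l - k < n div 2"
      using k l by (auto simp: centered_def of_nat_diff)
    then have "- x \<in> progression 1 2 (n div 2)" unfolding progression_def by blast
    then show ?thesis unfolding plus_minus_def by (metis UnI2 image_eqI minus_minus)
  next
    case False
    then have "x = 1 + of_nat (k - l - 1) * 2" "k - l - 1 < n div 2"
      using k l by (auto simp: centered_def of_nat_diff)
    then show ?thesis unfolding plus_minus_def progression_def by blast
  qed
qed

lemma centered_image_odd:
  assumes "odd n"
  shows "centered n ` {1..n} \<subseteq> (*) 2 ` {- int (n div 2)..int (n div 2)}"
proof
  fix x assume "x \<in> centered n ` {1..n}"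
  then obtain k where "k \<in> {1..n}" "x = centered n k" by blast
  then have "x = 2 * (int k - int (n div 2) - 1)"
    "int k - int (n div 2) - 1 \<in> {- int (n div 2)..int (n div 2)}"
    using assms by (auto simp: centered_def elim!: oddE)
  then show "x \<in> (*) 2 ` {- int (n div 2)..int (n div 2)}" by blast
qed

theorem magic_rectangle_exists:
  assumes "1 < p" "1 < q" "even p \<longleftrightarrow> even q" "\<not> (p = 2 \<and> q = 2)"
  obtains M where "magic_rectangle p q M"
proof (rule magic_rectangle_of_zero_sum_array)
  show "zero_sum_array p q (centered (p * q) ` {1..p * q})"
  proof (cases "even p")
    case True
    with assms have "zero_sum_array p q (plus_minus (progression (1 :: int) 2 (p * q div 2)))"
      by (intro zero_sum_array_odd_numbers) simp_all
    then show ?thesis by (rule zero_sum_array_mono) (use True in \<open>intro centered_image_even; simp\<close>)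
  next
    case False
    then have odd: "odd p" "odd q" "3 \<le> p" "3 \<le> q" using assms by presburger+
    from zero_sum_array_scale[OF zero_sum_array_odd[OF this], of 2]
    show ?thesis by (rule zero_sum_array_mono) (use odd in \<open>intro centered_image_odd; simp\<close>)
  qed
qed

section \<open>Chromatic and local antimagic chromatic numbers\<close>

lemma simple_graph_edge:
  assumes "simple_graph G" "{u, v} \<in> edges G"
  shows "u \<in> verts G" "v \<in> verts G" "u \<noteq> v"
  using assms unfolding simple_graph_def by (auto simp: card_insert_if)

lemma finite_edges:
  assumes "simple_graph G"
  shows "finite (edges G)"
  using assms unfolding simple_graph_def by (auto intro: finite_subset[of _ "Pow (verts G)"])

lemma chromatic_number_le_card_colors:
  assumes G: "simple_graph G" and c: "proper_coloring G c"
  shows "chromatic_number G \<le> card (c ` verts G)"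
proof -
  have "finite (c ` verts G)" using G unfolding simple_graph_def by simp
  then obtain g where g: "bij_betw g (c ` verts G) {0..<card (c ` verts G)}"
    using ex_bij_betw_finite_nat by blast
  have "proper_coloring G (g \<circ> c)"
    using c simple_graph_edge[OF G] bij_betw_imp_inj_on[OF g]
    unfolding proper_coloring_def by (auto dest: inj_onD)
  moreover have "(g \<circ> c) ` verts G \<subseteq> {..<card (c ` verts G)}"
    using bij_betwE[OF g] by auto
  ultimately show ?thesis
    unfolding chromatic_number_def by (blast intro: Least_le)
qed

lemma chromatic_number_coloring:
  assumes G: "simple_graph G"
  obtains c where "proper_coloring G c" "c ` verts G \<subseteq> {..<chromatic_number G}"
proof -
  have "finite (verts G)" using G unfolding simple_graph_def by simp
  then obtain g where g: "bij_betw g (verts G) {0..<card (verts G)}"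
    using ex_bij_betw_finite_nat by blast
  have "proper_coloring G g"
    unfolding proper_coloring_def
    using simple_graph_edge[OF G] inj_onD[OF bij_betw_imp_inj_on[OF g]] by metis
  moreover have "g ` verts G \<subseteq> {..<card (verts G)}"
    using bij_betw_imp_surj_on[OF g] by auto
  ultimately have "\<exists>k c. proper_coloring G c \<and> c ` verts G \<subseteq> {..<k}" by blast
  from LeastI_ex[OF this] show ?thesis
    using that unfolding chromatic_number_def by blast
qed

lemma chromatic_number_pos:
  assumes "simple_graph G" "verts G \<noteq> {}"
  shows "0 < chromatic_number G"
proof -
  obtain c where "c ` verts G \<subseteq> {..<chromatic_number G}"
    using chromatic_number_coloring[OF assms(1)] .
  with assms(2) show ?thesis by auto
qed

lemma chromatic_number_le_chi_la:
  assumes "simple_graph G"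
  shows "enat (chromatic_number G) \<le> chi_la G"
  unfolding chi_la_def local_antimagic_labeling_def
  by (intro INF_greatest)
    (auto intro!: chromatic_number_le_card_colors[OF assms] simp: proper_coloring_def)

lemma chi_la_le:
  "local_antimagic_labeling G f \<Longrightarrow> chi_la G \<le> enat (card (vertex_sum G f ` verts G))"
  unfolding chi_la_def by (intro INF_lower) simp

lemma chi_la_attained:
  assumes "chi_la G \<noteq> \<infinity>"
  obtains f where "local_antimagic_labeling G f" "chi_la G = enat (card (vertex_sum G f ` verts G))"
proof -
  let ?A = "(\<lambda>f. enat (card (vertex_sum G f ` verts G))) ` {f. local_antimagic_labeling G f}"
  have "?A \<noteq> {}"
  proof
    assume "?A = {}"
    then have "chi_la G = top" unfolding chi_la_def by (simp only: Inf_empty)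
    then show False using assms by (simp add: top_enat_def)
  qed
  then have "Inf ?A \<in> ?A" by (auto simp: Inf_enat_def intro: LeastI)
  then show ?thesis using that unfolding chi_la_def by auto
qed

section \<open>Joins of graphs\<close>

definition cross_edges :: "'a set \<Rightarrow> 'a set \<Rightarrow> 'a set set" where
  "cross_edges V W = {{v, w} | v w. v \<in> V \<and> w \<in> W}"

lemma verts_edgeless [simp]: "verts (edgeless W) = W"
  by (simp add: edgeless_def)

lemma edges_edgeless [simp]: "edges (edgeless W) = {}"
  by (simp add: edgeless_def)

lemma simple_graph_edgeless: "finite W \<Longrightarrow> simple_graph (edgeless W)"
  by (simp add: simple_graph_def)

lemma verts_graph_join [simp]: "verts (graph_join G H) = verts G \<union> verts H"
  by (simp add: graph_join_def)

lemma edges_graph_join: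
  "edges (graph_join G H) = edges G \<union> edges H \<union> cross_edges (verts G) (verts H)"
  by (simp add: graph_join_def cross_edges_def)

lemma graph_join_commute: "graph_join G H = graph_join H G"
proof -
  have "cross_edges (verts G) (verts H) = cross_edges (verts H) (verts G)"
    unfolding cross_edges_def by (auto simp: insert_commute)
  then show ?thesis by (simp add: graph_join_def cross_edges_def Un_commute)
qed

lemma simple_graph_join:
  assumes "simple_graph G" "simple_graph H" "verts G \<inter> verts H = {}"
  shows "simple_graph (graph_join G H)"
  using assms unfolding simple_graph_def edges_graph_join cross_edges_def
  by (auto simp: card_insert_if)

lemma edges_disjoint_cross_edges:
  assumes "simple_graph G" "verts G \<inter> W = {}"
  shows "edges G \<inter> cross_edges (verts G) W = {}"
  using assms unfolding cross_edges_def by (auto dest: simple_graph_edge)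

lemma card_verts_join:
  assumes "simple_graph G" "simple_graph H" "verts G \<inter> verts H = {}"
  shows "card (verts (graph_join G H)) = card (verts G) + card (verts H)"
  using assms by (simp add: simple_graph_def card_Un_disjoint)

lemma vertex_sum_join:
  assumes G: "simple_graph G" and H: "simple_graph H" and disj: "verts G \<inter> verts H = {}"
    and v: "v \<in> verts G"
  shows "vertex_sum (graph_join G H) f v = vertex_sum G f v + (\<Sum>w\<in>verts H. f {v, w})"
proof -
  have "{e \<in> edges (graph_join G H). v \<in> e} = {e \<in> edges G. v \<in> e} \<union> (\<lambda>w. {v, w}) ` verts H"
    using H disj v unfolding edges_graph_join cross_edges_def simple_graph_def by auto
  moreover have "{e \<in> edges G. v \<in> e} \<inter> (\<lambda>w. {v, w}) ` verts H = {}"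
    using disj simple_graph_edge[OF G] by blast
  moreover have "inj_on (\<lambda>w. {v, w}) (verts H)"
    by (auto simp: inj_on_def doubleton_eq_iff)
  ultimately show ?thesis
    using H finite_edges[OF G] unfolding vertex_sum_def simple_graph_def
    by (simp add: sum.union_disjoint sum.reindex)
qed

lemma degree_join:
  assumes "simple_graph G" "simple_graph H" "verts G \<inter> verts H = {}" "v \<in> verts G"
  shows "degree (graph_join G H) v = degree G v + card (verts H)"
  using vertex_sum_join[OF assms, of "\<lambda>_. 1"] by (simp add: vertex_sum_def degree_def)

lemma regular_join_edgeless:
  assumes G: "simple_graph G" "regular d G" and W: "finite W" "verts G \<inter> W = {}"
    and order: "card (verts G) = card W + d"
  shows "regular (d + card W) (graph_join G (edgeless W))"
  unfolding regular_def
proof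
  fix v assume v: "v \<in> verts (graph_join G (edgeless W))"
  show "degree (graph_join G (edgeless W)) v = d + card W"
  proof (cases "v \<in> verts G")
    case True
    then show ?thesis
      using degree_join[OF G(1) simple_graph_edgeless[OF W(1)]] G(2) W(2) by (simp add: regular_def)
  next
    case False
    then have "degree (graph_join (edgeless W) G) v = degree (edgeless W) v + card (verts G)"
      using v W(2) by (intro degree_join simple_graph_edgeless G W(1)) auto
    then show ?thesis using order by (simp add: degree_def graph_join_commute)
  qed
qed

lemma chromatic_number_join_ge:
  assumes G: "simple_graph G" and H: "simple_graph H" and disj: "verts G \<inter> verts H = {}"
  shows "chromatic_number G + chromatic_number H \<le> chromatic_number (graph_join G H)"
proof -
  let ?J = "graph_join G H"
  obtain c where c: "proper_coloring ?J c" "c ` verts ?J \<subseteq> {..<chromatic_number ?J}"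
    using chromatic_number_coloring[OF simple_graph_join[OF assms]] .
  have "proper_coloring G c" "proper_coloring H c"
    using c(1) unfolding proper_coloring_def edges_graph_join by blast+
  then have "chromatic_number G + chromatic_number H \<le> card (c ` verts G) + card (c ` verts H)"
    using G H by (intro add_mono chromatic_number_le_card_colors)
  also have "\<dots> = card (c ` verts ?J)"
  proof -
    have "c ` verts G \<inter> c ` verts H = {}"
      using c(1) unfolding proper_coloring_def edges_graph_join cross_edges_def by fastforce
    then show ?thesis
      using G H by (simp add: simple_graph_def image_Un card_Un_disjoint)
  qed
  also have "\<dots> \<le> chromatic_number ?J"
    using card_mono[OF _ c(2)] by simp
  finally show ?thesis .
qed

section \<open>Local antimagic labelings of joins\<close>

lemma magic_labeling_of_cross_edges:
  assumes V: "finite V" and W: "finite W" and disj: "V \<inter> W = {}"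
    and M: "magic_rectangle (card W) (card V) M"
  obtains g where "bij_betw g (cross_edges V W) {1..card W * card V}"
    "\<And>v. v \<in> V \<Longrightarrow> 2 * (\<Sum>w\<in>W. g {v, w}) = card W * (card W * card V + 1)"
    "\<And>w. w \<in> W \<Longrightarrow> 2 * (\<Sum>v\<in>V. g {v, w}) = card V * (card W * card V + 1)"
proof -
  obtain a where a: "bij_betw a W {..<card W}"
    using ex_bij_betw_finite_nat[OF W] unfolding atLeast0LessThan by blast
  obtain b where b: "bij_betw b V {..<card V}"
    using ex_bij_betw_finite_nat[OF V] unfolding atLeast0LessThan by blast
  have pair: "bij_betw (\<lambda>(w, v). {v, w}) (W \<times> V) (cross_edges V W)"
    using disj by (auto simp: bij_betw_def inj_on_def cross_edges_def doubleton_eq_iff)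
  define g where "g = (\<lambda>(i, j). M i j) \<circ> map_prod a b \<circ> inv_into (W \<times> V) (\<lambda>(w, v). {v, w})"
  have "bij_betw g (cross_edges V W) {1..card W * card V}"
    unfolding g_def using M a b pair
    by (auto intro!: bij_betw_trans bij_betw_map_prod bij_betw_inv_into simp: magic_rectangle_def)
  moreover have g: "g {v, w} = M (a w) (b v)" if "v \<in> V" "w \<in> W" for v w
    using bij_betw_inv_into_left[OF pair, of "(w, v)"] that by (simp add: g_def)
  moreover have "2 * (\<Sum>w\<in>W. g {v, w}) = card W * (card W * card V + 1)" if v: "v \<in> V" for v
  proof -
    have "(\<Sum>w\<in>W. g {v, w}) = (\<Sum>i<card W. M i (b v))"
      using g[OF v] sum.reindex_bij_betw[OF a, of "\<lambda>i. M i (b v)"] by simp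
    then show ?thesis using M bij_betwE[OF b] v unfolding magic_rectangle_def by simp
  qed
  moreover have "2 * (\<Sum>v\<in>V. g {v, w}) = card V * (card W * card V + 1)" if w: "w \<in> W" for w
  proof -
    have "(\<Sum>v\<in>V. g {v, w}) = (\<Sum>j<card V. M (a w) j)"
      using g w sum.reindex_bij_betw[OF b, of "M (a w)"] by simp
    then show ?thesis using M bij_betwE[OF a] w unfolding magic_rectangle_def by simp
  qed
  ultimately show ?thesis using that by blast
qed

locale labeled_join =
  fixes G :: "'a graph" and W :: "'a set" and d c R C :: nat and f g :: "'a set \<Rightarrow> nat"
  assumes simple: "simple_graph G" and regular: "regular d G"
    and finite_W: "finite W" and disjoint: "verts G \<inter> W = {}"
    and f: "local_antimagic_labeling G f"
    and g: "bij_betw g (cross_edges (verts G) W) {1..c}"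
    and cross_sum_old: "\<And>v. v \<in> verts G \<Longrightarrow> (\<Sum>w\<in>W. g {v, w}) = C"
    and cross_sum_new: "\<And>w. w \<in> W \<Longrightarrow> (\<Sum>v\<in>verts G. g {v, w}) = R"
    and less: "R < d * c + C"
begin

abbreviation J :: "'a graph" where
  "J \<equiv> graph_join G (edgeless W)"

definition labeling :: "'a set \<Rightarrow> nat" where
  "labeling e = (if e \<in> edges G then c + f e else g e)"

lemma labeling_cross: "v \<in> verts G \<Longrightarrow> w \<in> W \<Longrightarrow> labeling {v, w} = g {v, w}"
  using disjoint simple_graph_edge(2)[OF simple] by (auto simp: labeling_def)

lemma vertex_sum_old:
  assumes v: "v \<in> verts G"
  shows "vertex_sum J labeling v = vertex_sum G f v + (d * c + C)"
proof -
  have "vertex_sum G labeling v = (\<Sum>e\<in>{e \<in> edges G. v \<in> e}. c + f e)"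
    unfolding vertex_sum_def by (rule sum.cong) (auto simp: labeling_def)
  also have "\<dots> = degree G v * c + vertex_sum G f v"
    by (simp add: sum.distrib degree_def vertex_sum_def)
  finally have "vertex_sum G labeling v = d * c + vertex_sum G f v"
    using regular v unfolding regular_def by simp
  moreover have "(\<Sum>w\<in>W. labeling {v, w}) = C"
    using labeling_cross[OF v] cross_sum_old[OF v] by simp
  ultimately show ?thesis
    using vertex_sum_join[OF simple simple_graph_edgeless[OF finite_W]] disjoint v by simp
qed

lemma vertex_sum_new:
  assumes w: "w \<in> W"
  shows "vertex_sum J labeling w = R"
proof -
  have "vertex_sum J labeling w = (\<Sum>v\<in>verts G. labeling {w, v})"
    using vertex_sum_join[OF simple_graph_edgeless[OF finite_W] simple, of w labeling] disjoint w
    by (simp add: graph_join_commute vertex_sum_def inf_commute)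
  also have "\<dots> = R" using labeling_cross w cross_sum_new[OF w] by (simp add: insert_commute)
  finally show ?thesis .
qed

lemma bij_betw_labeling: "bij_betw labeling (edges J) {1..card (edges J)}"
proof -
  define q where "q = card (edges G)"
  have "bij_betw ((+) c) {1..q} {c + 1..c + q}" by (auto simp: bij_betw_def)
  moreover have "bij_betw f (edges G) {1..q}"
    using f unfolding local_antimagic_labeling_def q_def by blast
  ultimately have "bij_betw ((+) c \<circ> f) (edges G) {c + 1..c + q}" by (rule bij_betw_trans[rotated])
  then have "bij_betw labeling (edges G) {c + 1..c + q}"
    by (rule bij_betw_cong[THEN iffD1, rotated]) (simp add: labeling_def)
  moreover have "bij_betw labeling (cross_edges (verts G) W) {1..c}"
    using g by (rule bij_betw_cong[THEN iffD1, rotated])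
      (use edges_disjoint_cross_edges[OF simple disjoint] in \<open>auto simp: labeling_def\<close>)
  ultimately have "bij_betw labeling (edges G \<union> cross_edges (verts G) W) ({c + 1..c + q} \<union> {1..c})"
    by (rule bij_betw_combine) auto
  moreover have "{c + 1..c + q} \<union> {1..c} = {1..c + q}" by auto
  ultimately have bij: "bij_betw labeling (edges J) {1..c + q}" by (simp add: edges_graph_join)
  from bij_betw_same_card[OF this] have "card (edges J) = c + q" by simp
  with bij show ?thesis by simp
qed

lemma local_antimagic: "local_antimagic_labeling J labeling"
proof -
  have "vertex_sum J labeling u \<noteq> vertex_sum J labeling v" if uv: "{u, v} \<in> edges J" for u v
  proof (cases "{u, v} \<in> edges G")
    case True
    then have "vertex_sum G f u \<noteq> vertex_sum G f v"
      using f unfolding local_antimagic_labeling_def by blast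
    then show ?thesis using vertex_sum_old simple_graph_edge[OF simple True] by simp
  next
    case False
    then have "u \<in> verts G \<and> v \<in> W \<or> v \<in> verts G \<and> u \<in> W"
      using uv unfolding edges_graph_join cross_edges_def by (auto simp: doubleton_eq_iff)
    then show ?thesis using vertex_sum_old vertex_sum_new less by force
  qed
  with bij_betw_labeling show ?thesis unfolding local_antimagic_labeling_def by blast
qed

lemma card_vertex_sums_le:
  "card (vertex_sum J labeling ` verts J) \<le> card (vertex_sum G f ` verts G) + 1"
proof -
  let ?S = "vertex_sum G f ` verts G"
  have fin: "finite ?S" using simple unfolding simple_graph_def by simp
  have "vertex_sum J labeling ` verts J \<subseteq> insert R ((\<lambda>s. s + (d * c + C)) ` ?S)"
    using vertex_sum_old vertex_sum_new by auto
  then have "card (vertex_sum J labeling ` verts J) \<le> card (insert R ((\<lambda>s. s + (d * c + C)) ` ?S))"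
    using fin by (intro card_mono) auto
  also have "\<dots> \<le> card ((\<lambda>s. s + (d * c + C)) ` ?S) + 1"
    using fin by (simp add: card_insert_if)
  also have "\<dots> \<le> card ?S + 1"
    using card_image_le[OF fin] by simp
  finally show ?thesis .
qed

end

lemma magic_constant_less:
  fixes m n d :: nat
  assumes "1 < n * m" "0 < d" "m \<le> n + d"
  shows "m * (n * m + 1) < n * (n * m + 1) + 2 * (d * (n * m))"
proof -
  have "m * (n * m + 1) \<le> (n + d) * (n * m + 1)"
    using assms(3) by (rule mult_le_mono1)
  also have "\<dots> < n * (n * m + 1) + d * (2 * (n * m))"
  proof -
    have "n * m + 1 < 2 * (n * m)" using assms(1) by linarith
    then have "d * (n * m + 1) < d * (2 * (n * m))" using assms(2) by simp
    then show ?thesis by (simp only: distrib_right)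
  qed
  finally show ?thesis by (simp only: mult.left_commute)
qed

lemma chi_la_join_edgeless_le:
  assumes G: "simple_graph G" "regular d G" "0 < d" "3 \<le> card (verts G)"
    and W: "finite W" "verts G \<inter> W = {}" "2 \<le> card W"
    and order: "card (verts G) \<le> card W + d" "even (card (verts G)) \<longleftrightarrow> even (card W)"
  shows "chi_la (graph_join G (edgeless W)) \<le> chi_la G + 1"
proof (cases "chi_la G = \<infinity>")
  case False
  then obtain f where f: "local_antimagic_labeling G f"
      "chi_la G = enat (card (vertex_sum G f ` verts G))"
    by (rule chi_la_attained)
  define m n where "m = card (verts G)" and "n = card W"
  have "1 < n" "1 < m" "even n \<longleftrightarrow> even m" "\<not> (n = 2 \<and> m = 2)"
    using G(4) W(3) order(2) unfolding m_def n_def by auto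
  then obtain M where M: "magic_rectangle n m M" by (rule magic_rectangle_exists)
  have "finite (verts G)" using G(1) unfolding simple_graph_def by blast
  then obtain g where g: "bij_betw g (cross_edges (verts G) W) {1..n * m}"
      "\<And>v. v \<in> verts G \<Longrightarrow> 2 * (\<Sum>w\<in>W. g {v, w}) = n * (n * m + 1)"
      "\<And>w. w \<in> W \<Longrightarrow> 2 * (\<Sum>v\<in>verts G. g {v, w}) = m * (n * m + 1)"
    using magic_labeling_of_cross_edges[OF _ W(1,2)] M unfolding m_def n_def by blast
  have "verts G \<noteq> {}" "W \<noteq> {}" using G(4) W(3) by auto
  then obtain v\<^sub>0 w\<^sub>0 where "v\<^sub>0 \<in> verts G" "w\<^sub>0 \<in> W" by blast
  define C R where "C = (\<Sum>w\<in>W. g {v\<^sub>0, w})" and "R = (\<Sum>v\<in>verts G. g {v, w\<^sub>0})"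
  have C: "2 * C = n * (n * m + 1)" and R: "2 * R = m * (n * m + 1)"
    unfolding C_def R_def using g(2,3) \<open>v\<^sub>0 \<in> verts G\<close> \<open>w\<^sub>0 \<in> W\<close> by blast+
  have "m * (n * m + 1) < n * (n * m + 1) + 2 * (d * (n * m))"
    using \<open>1 < n\<close> \<open>1 < m\<close> G(3) order(1)
    by (intro magic_constant_less less_1_mult) (auto simp: m_def n_def)
  then have "R < d * (n * m) + C" using C R by linarith
  then interpret join: labeled_join G W d "n * m" R C f g
    using G W f(1) g(1) g(2,3)[folded C R] by unfold_locales simp_all
  show ?thesis
    using chi_la_le[OF join.local_antimagic] join.card_vertex_sums_le
    unfolding f(2) one_enat_def by (simp add: order_trans)
qed simp

lemma chi_la_join_edgeless:
  assumes "simple_graph G" "regular d G" "0 < d" "3 \<le> card (verts G)"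
    and "finite W" "verts G \<inter> W = {}" "2 \<le> card W"
    and "card (verts G) \<le> card W + d" "even (card (verts G)) \<longleftrightarrow> even (card W)"
    and chi: "enat (chromatic_number G) = chi_la G"
  shows "chi_la (graph_join G (edgeless W)) = chi_la G + 1"
    and "enat (chromatic_number (graph_join G (edgeless W))) = chi_la (graph_join G (edgeless W))"
proof -
  let ?J = "graph_join G (edgeless W)"
  have W: "simple_graph (edgeless W)" "verts (edgeless W) \<noteq> {}"
    using simple_graph_edgeless[OF assms(5)] assms(7) by auto
  have "chi_la G + 1 = enat (chromatic_number G + 1)" unfolding chi[symmetric] one_enat_def by simp
  also have "\<dots> \<le> enat (chromatic_number G + chromatic_number (edgeless W))"
    using chromatic_number_pos[OF W] by simp
  also have "\<dots> \<le> enat (chromatic_number ?J)"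
    using chromatic_number_join_ge[OF assms(1) W(1)] assms(6) by simp
  finally have "chi_la G + 1 \<le> enat (chromatic_number ?J)" .
  moreover have "enat (chromatic_number ?J) \<le> chi_la ?J"
    using assms(1,6) W(1) by (intro chromatic_number_le_chi_la simple_graph_join) simp_all
  moreover have "chi_la ?J \<le> chi_la G + 1"
    using assms by (intro chi_la_join_edgeless_le)
  ultimately show "chi_la ?J = chi_la G + 1" "enat (chromatic_number ?J) = chi_la ?J" by order+
qed

lemma regular_iterated_join:
  assumes "iterated_join G n k H"
    and "simple_graph G" "regular d G" "card (verts G) = n + d"
  shows "simple_graph H" "regular (d + k * n) H" "card (verts H) = n + d + k * n"
proof -
  from assms have "simple_graph H \<and> regular (d + k * n) H \<and> card (verts H) = n + d + k * n"
  proof induction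
    case base
    then show ?case by simp
  next
    case (step k H W)
    then show ?case
      using regular_join_edgeless[of H "d + k * n" W] simple_graph_join[of H "edgeless W"]
        card_verts_join[of H "edgeless W"] simple_graph_edgeless[of W]
      by (simp add: add_ac)
  qed
  then show "simple_graph H" "regular (d + k * n) H" "card (verts H) = n + d + k * n" by blast+
qed

lemma chi_la_iterated_join:
  assumes "iterated_join G n k H"
    and G: "simple_graph G" "regular d G" "card (verts G) = n + d"
    and sizes: "even n" "even d" "2 \<le> n" "0 < d"
    and chi: "enat (chromatic_number G) = chi_la G"
  shows "chi_la H = chi_la G + enat k"
proof -
  from assms(1) have "chi_la H = chi_la G + enat k \<and> enat (chromatic_number H) = chi_la H"
  proof induction
    case base
    then show ?case using chi by (simp flip: zero_enat_def)
  next
    case (step k H W)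
    note H = regular_iterated_join[OF step.hyps(1) G]
    have "0 < d + k * n" "3 \<le> card (verts H)" "2 \<le> card W"
      "card (verts H) \<le> card W + (d + k * n)" "even (card (verts H)) \<longleftrightarrow> even (card W)"
      using H(3) step.hyps(3) sizes by simp_all
    note join = chi_la_join_edgeless
      [OF H(1,2) this(1,2) step.hyps(2,4) this(3-5) conjunct2[OF step.IH]]
    have "chi_la G + enat k + 1 = chi_la G + enat (Suc k)"
      by (simp add: add.assoc one_enat_def)
    then show ?case using join step.IH by simp
  qed
  then show ?thesis ..
qed

theorem theorem3p3:
  fixes G :: "'a graph" and m r :: nat
  assumes "simple_graph G"
    and "regular (2 * r) G"
    and "card (verts G) = m"
    and "m \<ge> 3"
    and "enat (chromatic_number G) = chi_la G"
    and "r \<ge> 2"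
  shows
    "(\<forall>t W. 1 \<le> t \<and> t \<le> r \<and> m - 2 * t \<ge> 2 \<and>
        finite W \<and> card W = m - 2 * t \<and> verts G \<inter> W = {} \<longrightarrow>
        chi_la (graph_join G (edgeless W)) = chi_la G + 1) \<and>
     (even m \<and> m - 2 * r \<ge> 2 \<longrightarrow>
        (\<forall>k H. iterated_join G (m - 2 * r) (Suc k) H \<longrightarrow>
           simple_graph H \<and>
           regular (2 * r + (k + 1) * (m - 2 * r)) H \<and>
           card (verts H) = m + (k + 1) * (m - 2 * r)) \<and>
        (\<forall>k H. iterated_join G (m - 2 * r) k H \<longrightarrow> chi_la H = chi_la G + enat k))"
proof (intro conjI allI impI)
  fix t W
  assume "1 \<le> t \<and> t \<le> r \<and> m - 2 * t \<ge> 2 \<and> finite W \<and> card W = m - 2 * t \<and> verts G \<inter> W = {}"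
  then show "chi_la (graph_join G (edgeless W)) = chi_la G + 1"
    using assms by (intro chi_la_join_edgeless(1)[where d = "2 * r"]) auto
next
  fix k H
  assume n: "even m \<and> m - 2 * r \<ge> 2" and H: "iterated_join G (m - 2 * r) (Suc k) H"
  from n have "card (verts G) = m - 2 * r + 2 * r" using assms(3) by linarith
  from regular_iterated_join[OF H assms(1,2) this] this assms(3)
  show "simple_graph H" "regular (2 * r + (k + 1) * (m - 2 * r)) H"
    "card (verts H) = m + (k + 1) * (m - 2 * r)" by simp_all
next
  fix k H
  assume "even m \<and> m - 2 * r \<ge> 2" "iterated_join G (m - 2 * r) k H"
  then show "chi_la H = chi_la G + enat k"
    using assms by (intro chi_la_iterated_join[where n = "m - 2 * r" and d = "2 * r"]) auto
qed

end
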